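(* Let $A$ be an associative algebra over $\mathbb F$, let $M$ be an $A$-$A$-bimodule, and let $c\in HH^3(A,M)$. Then there exist an associative algebra $K$ containing $M$ as a subspace with $\mathrm{Anni}K=M$, and a coupling $\xi:A\to\mathrm{Out}(K)$ admitting a bimultiplication law $\mu=(u,v)$ covering $\xi$, such that: (1) $a\mapsto u_a$ is an algebra homomorphism $A\to\mathrm{End}_{\mathbb F}(K)$ (so $K$ is a left $A$-module); (2) the $A$-bimodule structure induced by $\xi$ on $\mathrm{Anni}K=M$ coincides with the given bimodule structure of $M$; (3) $\mathrm{Obs}(\xi)=c$.
   Context: All algebras are associative, not necessarily unital, over a field $\mathbb F$. For an algebra $K$, a bimultiplication of $K$ is a pair $(u,v)$ of linear maps $K\to K$ with $k_1u(k_2)=v(k_1)k_2$, $u(k_1k_2)=u(k_1)k_2$, $v(k_1k_2)=k_1v(k_2)$; these form an algebra $\mathrm{Mul}(K)$ with product $(u_1,v_1)(u_2,v_2)=(u_1\circ u_2,\ v_2\circ v_1)$. $\epsilon:K\to\mathrm{Mul}(K)$, $\epsilon(k_0)=(k\mapsto k_0k,\ k\mapsto kk_0)$; $\mathrm{Inn}(K)=\epsilon(K)$, $\mathrm{Out}(K)=\mathrm{Mul}(K)/\mathrm{Inn}(K)$ with projection $\natural$; $\mathrm{Anni}K=\{k: kK=0=Kk\}$. A coupling is an algebra homomorphism $\xi:A\to\mathrm{Out}(K)$. A bimultiplication law covering $\xi$ is a linear map $\mu:A\to\mathrm{Mul}(K)$, $\mu(a)=(u_a,v_a)$, with $\natural\circ\mu=\xi$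 and $u_av_b=v_bu_a$ for all $a,b\in A$; then $\mathrm{Anni}K$ is an $A$-bimodule via $a\cdot n=u_a(n)$, $n\cdot a=v_a(n)$, independent of $\mu$. Curvature $R^\mu(a_1,a_2)=\mu(a_1)\mu(a_2)-\mu(a_1a_2)\in\mathrm{Inn}(K)$; a hindrance is a bilinear $h:A\times A\to K$ with $\epsilon\circ h=R^\mu$; $f(\mu,h)(a_1,a_2,a_3)=u_{a_1}h(a_2,a_3)-h(a_1a_2,a_3)+h(a_1,a_2a_3)-v_{a_3}h(a_1,a_2)$ is a Hochschild 3-cocycle of $A$ with values in $\mathrm{Anni}K$, and its class $\mathrm{Obs}(\xi)\in HH^3(A,\mathrm{Anni}K)$ is independent of $\mu$ and $h$. *)

theory Defs
  imports Complex_Main "HOL-Library.Function_Algebras"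
begin

text \<open>An associative (not necessarily unital) algebra over the field 'f is a type of class
  ring (associative, distributive, no unit required) which is an 'f-vector space via sA,
  with multiplication bilinear.\<close>
definition assoc_algebra :: "('f::field \<Rightarrow> 'a::ring \<Rightarrow> 'a) \<Rightarrow> bool" where
  "assoc_algebra sA \<longleftrightarrow> vector_space sA \<and>
     (\<forall>c x y. sA c (x * y) = sA c x * y \<and> sA c (x * y) = x * sA c y)"

definition bilin :: "('f::field \<Rightarrow> 'a::ab_group_add \<Rightarrow> 'a) \<Rightarrow> ('f \<Rightarrow> 'b::ab_group_add \<Rightarrow> 'b)
    \<Rightarrow> ('f \<Rightarrow> 'c::ab_group_add \<Rightarrow> 'c) \<Rightarrow> ('a \<Rightarrow> 'b \<Rightarrow> 'c) \<Rightarrow> bool" where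
  "bilin s1 s2 s3 g \<longleftrightarrow> (\<forall>x. Vector_Spaces.linear s2 s3 (g x)) \<and>
     (\<forall>y. Vector_Spaces.linear s1 s3 (\<lambda>x. g x y))"

definition trilin :: "('f::field \<Rightarrow> 'a::ab_group_add \<Rightarrow> 'a) \<Rightarrow> ('f \<Rightarrow> 'm::ab_group_add \<Rightarrow> 'm)
    \<Rightarrow> ('a \<Rightarrow> 'a \<Rightarrow> 'a \<Rightarrow> 'm) \<Rightarrow> bool" where
  "trilin sA sM f \<longleftrightarrow> (\<forall>y z. Vector_Spaces.linear sA sM (\<lambda>x. f x y z)) \<and>
     (\<forall>x z. Vector_Spaces.linear sA sM (\<lambda>y. f x y z)) \<and>
     (\<forall>x y. Vector_Spaces.linear sA sM (\<lambda>z. f x y z))"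

definition bimodule :: "('f::field \<Rightarrow> 'a::ring \<Rightarrow> 'a) \<Rightarrow> ('f \<Rightarrow> 'm::ab_group_add \<Rightarrow> 'm)
    \<Rightarrow> ('a \<Rightarrow> 'm \<Rightarrow> 'm) \<Rightarrow> ('m \<Rightarrow> 'a \<Rightarrow> 'm) \<Rightarrow> bool" where
  "bimodule sA sM la ra \<longleftrightarrow> vector_space sM \<and> bilin sA sM sM la \<and> bilin sM sA sM ra \<and>
     (\<forall>a b m. la (a * b) m = la a (la b m)) \<and>
     (\<forall>a b m. ra m (a * b) = ra (ra m a) b) \<and>
     (\<forall>a b m. ra (la a m) b = la a (ra m b))"

definition hoch_d2 :: "('a::ring \<Rightarrow> 'm \<Rightarrow> 'm::ab_group_add) \<Rightarrow> ('m \<Rightarrow> 'a \<Rightarrow> 'm)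
    \<Rightarrow> ('a \<Rightarrow> 'a \<Rightarrow> 'm) \<Rightarrow> ('a \<Rightarrow> 'a \<Rightarrow> 'a \<Rightarrow> 'm)" where
  "hoch_d2 la ra g = (\<lambda>a1 a2 a3. la a1 (g a2 a3) - g (a1 * a2) a3 + g a1 (a2 * a3) - ra (g a1 a2) a3)"

definition hoch_3cocycle :: "('f::field \<Rightarrow> 'a::ring \<Rightarrow> 'a) \<Rightarrow> ('f \<Rightarrow> 'm::ab_group_add \<Rightarrow> 'm)
    \<Rightarrow> ('a \<Rightarrow> 'm \<Rightarrow> 'm) \<Rightarrow> ('m \<Rightarrow> 'a \<Rightarrow> 'm) \<Rightarrow> ('a \<Rightarrow> 'a \<Rightarrow> 'a \<Rightarrow> 'm) \<Rightarrow> bool" where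
  "hoch_3cocycle sA sM la ra f \<longleftrightarrow> trilin sA sM f \<and>
     (\<forall>a1 a2 a3 a4. la a1 (f a2 a3 a4) - f (a1 * a2) a3 a4 + f a1 (a2 * a3) a4
        - f a1 a2 (a3 * a4) + ra (f a1 a2 a3) a4 = 0)"

definition hh3_class :: "('f::field \<Rightarrow> 'a::ring \<Rightarrow> 'a) \<Rightarrow> ('f \<Rightarrow> 'm::ab_group_add \<Rightarrow> 'm)
    \<Rightarrow> ('a \<Rightarrow> 'm \<Rightarrow> 'm) \<Rightarrow> ('m \<Rightarrow> 'a \<Rightarrow> 'm) \<Rightarrow> ('a \<Rightarrow> 'a \<Rightarrow> 'a \<Rightarrow> 'm)
    \<Rightarrow> ('a \<Rightarrow> 'a \<Rightarrow> 'a \<Rightarrow> 'm) set" where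
  "hh3_class sA sM la ra f = {f'. hoch_3cocycle sA sM la ra f' \<and>
     (\<exists>g. bilin sA sA sM g \<and> (\<forall>a1 a2 a3. f' a1 a2 a3 = f a1 a2 a3 + hoch_d2 la ra g a1 a2 a3))}"

definition HH3 :: "('f::field \<Rightarrow> 'a::ring \<Rightarrow> 'a) \<Rightarrow> ('f \<Rightarrow> 'm::ab_group_add \<Rightarrow> 'm)
    \<Rightarrow> ('a \<Rightarrow> 'm \<Rightarrow> 'm) \<Rightarrow> ('m \<Rightarrow> 'a \<Rightarrow> 'm) \<Rightarrow> ('a \<Rightarrow> 'a \<Rightarrow> 'a \<Rightarrow> 'm) set set" where
  "HH3 sA sM la ra = {hh3_class sA sM la ra f | f. hoch_3cocycle sA sM la ra f}"

definition algebra_on :: "('f::field \<Rightarrow> 'k::ab_group_add \<Rightarrow> 'k) \<Rightarrow> 'k set \<Rightarrow> ('k \<Rightarrow> 'k \<Rightarrow> 'k) \<Rightarrow> bool" where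
  "algebra_on sK Kc mK \<longleftrightarrow> vector_space sK \<and> 0 \<in> Kc \<and>
     (\<forall>x\<in>Kc. \<forall>y\<in>Kc. x + y \<in> Kc \<and> mK x y \<in> Kc) \<and> (\<forall>c. \<forall>x\<in>Kc. sK c x \<in> Kc) \<and>
     (\<forall>x\<in>Kc. \<forall>y\<in>Kc. \<forall>z\<in>Kc. mK (x + y) z = mK x z + mK y z \<and> mK z (x + y) = mK z x + mK z y) \<and>
     (\<forall>c. \<forall>x\<in>Kc. \<forall>y\<in>Kc. mK (sK c x) y = sK c (mK x y) \<and> mK x (sK c y) = sK c (mK x y)) \<and>
     (\<forall>x\<in>Kc. \<forall>y\<in>Kc. \<forall>z\<in>Kc. mK (mK x y) z = mK x (mK y z))"

text \<open>Linear maps K \<rightarrow> K, represented extensionally (value 0 outside the carrier).\<close>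
definition klin :: "('f::field \<Rightarrow> 'k::ab_group_add \<Rightarrow> 'k) \<Rightarrow> 'k set \<Rightarrow> ('k \<Rightarrow> 'k) \<Rightarrow> bool" where
  "klin sK Kc u \<longleftrightarrow> (\<forall>x\<in>Kc. u x \<in> Kc) \<and> (\<forall>x. x \<notin> Kc \<longrightarrow> u x = 0) \<and>
     (\<forall>x\<in>Kc. \<forall>y\<in>Kc. u (x + y) = u x + u y) \<and> (\<forall>c. \<forall>x\<in>Kc. u (sK c x) = sK c (u x))"

definition Mul :: "('f::field \<Rightarrow> 'k::ab_group_add \<Rightarrow> 'k) \<Rightarrow> 'k set \<Rightarrow> ('k \<Rightarrow> 'k \<Rightarrow> 'k)
    \<Rightarrow> (('k \<Rightarrow> 'k) \<times> ('k \<Rightarrow> 'k)) set" where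
  "Mul sK Kc mK = {(u, v). klin sK Kc u \<and> klin sK Kc v \<and>
     (\<forall>k1\<in>Kc. \<forall>k2\<in>Kc. mK k1 (u k2) = mK (v k1) k2 \<and>
        u (mK k1 k2) = mK (u k1) k2 \<and> v (mK k1 k2) = mK k1 (v k2))}"

definition mul_add :: "('k \<Rightarrow> 'k::ab_group_add) \<times> ('k \<Rightarrow> 'k) \<Rightarrow> ('k \<Rightarrow> 'k) \<times> ('k \<Rightarrow> 'k)
    \<Rightarrow> ('k \<Rightarrow> 'k) \<times> ('k \<Rightarrow> 'k)" where
  "mul_add p q = (\<lambda>x. fst p x + fst q x, \<lambda>x. snd p x + snd q x)"

definition mul_diff :: "('k \<Rightarrow> 'k::ab_group_add) \<times> ('k \<Rightarrow> 'k) \<Rightarrow> ('k \<Rightarrow> 'k) \<times> ('k \<Rightarrow> 'k)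
    \<Rightarrow> ('k \<Rightarrow> 'k) \<times> ('k \<Rightarrow> 'k)" where
  "mul_diff p q = (\<lambda>x. fst p x - fst q x, \<lambda>x. snd p x - snd q x)"

definition mul_scale :: "('f::field \<Rightarrow> 'k::ab_group_add \<Rightarrow> 'k) \<Rightarrow> 'f
    \<Rightarrow> ('k \<Rightarrow> 'k) \<times> ('k \<Rightarrow> 'k) \<Rightarrow> ('k \<Rightarrow> 'k) \<times> ('k \<Rightarrow> 'k)" where
  "mul_scale sK c p = (\<lambda>x. sK c (fst p x), \<lambda>x. sK c (snd p x))"

definition mul_prod :: "('k \<Rightarrow> 'k) \<times> ('k \<Rightarrow> 'k) \<Rightarrow> ('k \<Rightarrow> 'k) \<times> ('k \<Rightarrow> 'k)
    \<Rightarrow> ('k \<Rightarrow> 'k) \<times> ('k \<Rightarrow> 'k)" where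
  "mul_prod p q = (fst p \<circ> fst q, snd q \<circ> snd p)"

definition eps :: "'k set \<Rightarrow> ('k \<Rightarrow> 'k \<Rightarrow> 'k::ab_group_add) \<Rightarrow> 'k \<Rightarrow> ('k \<Rightarrow> 'k) \<times> ('k \<Rightarrow> 'k)" where
  "eps Kc mK k0 = (\<lambda>k. if k \<in> Kc then mK k0 k else 0, \<lambda>k. if k \<in> Kc then mK k k0 else 0)"

definition Inn :: "'k set \<Rightarrow> ('k \<Rightarrow> 'k \<Rightarrow> 'k::ab_group_add) \<Rightarrow> (('k \<Rightarrow> 'k) \<times> ('k \<Rightarrow> 'k)) set" where
  "Inn Kc mK = eps Kc mK ` Kc"

definition natproj :: "'k set \<Rightarrow> ('k \<Rightarrow> 'k \<Rightarrow> 'k::ab_group_add) \<Rightarrow> ('k \<Rightarrow> 'k) \<times> ('k \<Rightarrow> 'k)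
    \<Rightarrow> (('k \<Rightarrow> 'k) \<times> ('k \<Rightarrow> 'k)) set" where
  "natproj Kc mK p = mul_add p ` Inn Kc mK"

definition Out :: "('f::field \<Rightarrow> 'k::ab_group_add \<Rightarrow> 'k) \<Rightarrow> 'k set \<Rightarrow> ('k \<Rightarrow> 'k \<Rightarrow> 'k)
    \<Rightarrow> (('k \<Rightarrow> 'k) \<times> ('k \<Rightarrow> 'k)) set set" where
  "Out sK Kc mK = natproj Kc mK ` Mul sK Kc mK"

definition out_add :: "'k set \<Rightarrow> ('k \<Rightarrow> 'k \<Rightarrow> 'k::ab_group_add)
    \<Rightarrow> (('k \<Rightarrow> 'k) \<times> ('k \<Rightarrow> 'k)) set \<Rightarrow> (('k \<Rightarrow> 'k) \<times> ('k \<Rightarrow> 'k)) set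
    \<Rightarrow> (('k \<Rightarrow> 'k) \<times> ('k \<Rightarrow> 'k)) set" where
  "out_add Kc mK X Y = natproj Kc mK (mul_add (SOME x. x \<in> X) (SOME y. y \<in> Y))"

definition out_scale :: "('f::field \<Rightarrow> 'k::ab_group_add \<Rightarrow> 'k) \<Rightarrow> 'k set \<Rightarrow> ('k \<Rightarrow> 'k \<Rightarrow> 'k)
    \<Rightarrow> 'f \<Rightarrow> (('k \<Rightarrow> 'k) \<times> ('k \<Rightarrow> 'k)) set \<Rightarrow> (('k \<Rightarrow> 'k) \<times> ('k \<Rightarrow> 'k)) set" where
  "out_scale sK Kc mK c X = natproj Kc mK (mul_scale sK c (SOME x. x \<in> X))"

definition out_mult :: "'k set \<Rightarrow> ('k \<Rightarrow> 'k \<Rightarrow> 'k::ab_group_add)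
    \<Rightarrow> (('k \<Rightarrow> 'k) \<times> ('k \<Rightarrow> 'k)) set \<Rightarrow> (('k \<Rightarrow> 'k) \<times> ('k \<Rightarrow> 'k)) set
    \<Rightarrow> (('k \<Rightarrow> 'k) \<times> ('k \<Rightarrow> 'k)) set" where
  "out_mult Kc mK X Y = natproj Kc mK (mul_prod (SOME x. x \<in> X) (SOME y. y \<in> Y))"

definition Anni :: "'k set \<Rightarrow> ('k \<Rightarrow> 'k \<Rightarrow> 'k::ab_group_add) \<Rightarrow> 'k set" where
  "Anni Kc mK = {k \<in> Kc. \<forall>x\<in>Kc. mK k x = 0 \<and> mK x k = 0}"

definition coupling :: "('f::field \<Rightarrow> 'a::ring \<Rightarrow> 'a) \<Rightarrow> ('f \<Rightarrow> 'k::ab_group_add \<Rightarrow> 'k) \<Rightarrow> 'k set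
    \<Rightarrow> ('k \<Rightarrow> 'k \<Rightarrow> 'k) \<Rightarrow> ('a \<Rightarrow> (('k \<Rightarrow> 'k) \<times> ('k \<Rightarrow> 'k)) set) \<Rightarrow> bool" where
  "coupling sA sK Kc mK \<xi> \<longleftrightarrow> (\<forall>a. \<xi> a \<in> Out sK Kc mK) \<and>
     (\<forall>a b. \<xi> (a + b) = out_add Kc mK (\<xi> a) (\<xi> b)) \<and>
     (\<forall>c a. \<xi> (sA c a) = out_scale sK Kc mK c (\<xi> a)) \<and>
     (\<forall>a b. \<xi> (a * b) = out_mult Kc mK (\<xi> a) (\<xi> b))"

definition bimult_law :: "('f::field \<Rightarrow> 'a::ring \<Rightarrow> 'a) \<Rightarrow> ('f \<Rightarrow> 'k::ab_group_add \<Rightarrow> 'k) \<Rightarrow> 'k set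
    \<Rightarrow> ('k \<Rightarrow> 'k \<Rightarrow> 'k) \<Rightarrow> ('a \<Rightarrow> (('k \<Rightarrow> 'k) \<times> ('k \<Rightarrow> 'k)) set)
    \<Rightarrow> ('a \<Rightarrow> ('k \<Rightarrow> 'k) \<times> ('k \<Rightarrow> 'k)) \<Rightarrow> bool" where
  "bimult_law sA sK Kc mK \<xi> \<mu> \<longleftrightarrow> (\<forall>a. \<mu> a \<in> Mul sK Kc mK) \<and>
     (\<forall>a b. \<mu> (a + b) = mul_add (\<mu> a) (\<mu> b)) \<and>
     (\<forall>c a. \<mu> (sA c a) = mul_scale sK c (\<mu> a)) \<and>
     (\<forall>a. natproj Kc mK (\<mu> a) = \<xi> a) \<and>
     (\<forall>a b. \<forall>k\<in>Kc. fst (\<mu> a) (snd (\<mu> b) k) = snd (\<mu> b) (fst (\<mu> a) k))"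

definition curvature :: "('a::ring \<Rightarrow> ('k \<Rightarrow> 'k::ab_group_add) \<times> ('k \<Rightarrow> 'k))
    \<Rightarrow> 'a \<Rightarrow> 'a \<Rightarrow> ('k \<Rightarrow> 'k) \<times> ('k \<Rightarrow> 'k)" where
  "curvature \<mu> a1 a2 = mul_diff (mul_prod (\<mu> a1) (\<mu> a2)) (\<mu> (a1 * a2))"

definition hindrance :: "('f::field \<Rightarrow> 'a::ring \<Rightarrow> 'a) \<Rightarrow> ('f \<Rightarrow> 'k::ab_group_add \<Rightarrow> 'k) \<Rightarrow> 'k set
    \<Rightarrow> ('k \<Rightarrow> 'k \<Rightarrow> 'k) \<Rightarrow> ('a \<Rightarrow> ('k \<Rightarrow> 'k) \<times> ('k \<Rightarrow> 'k)) \<Rightarrow> ('a \<Rightarrow> 'a \<Rightarrow> 'k) \<Rightarrow> bool" where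
  "hindrance sA sK Kc mK \<mu> h \<longleftrightarrow> (\<forall>a1 a2. h a1 a2 \<in> Kc) \<and> bilin sA sA sK h \<and>
     (\<forall>a1 a2. eps Kc mK (h a1 a2) = curvature \<mu> a1 a2)"

definition obs_cocycle :: "('a::ring \<Rightarrow> ('k \<Rightarrow> 'k::ab_group_add) \<times> ('k \<Rightarrow> 'k)) \<Rightarrow> ('a \<Rightarrow> 'a \<Rightarrow> 'k)
    \<Rightarrow> 'a \<Rightarrow> 'a \<Rightarrow> 'a \<Rightarrow> 'k" where
  "obs_cocycle \<mu> h a1 a2 a3 = fst (\<mu> a1) (h a2 a3) - h (a1 * a2) a3 + h a1 (a2 * a3) - snd (\<mu> a3) (h a1 a2)"

text \<open>Obs(\<xi>) is the class of f(\<mu>,h) for (any, here: a chosen) bimultiplication law \<mu> covering \<xi>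
  and hindrance h for \<mu>; we return the chosen representative cocycle f(\<mu>,h).\<close>
definition Obs_rep :: "('f::field \<Rightarrow> 'a::ring \<Rightarrow> 'a) \<Rightarrow> ('f \<Rightarrow> 'k::ab_group_add \<Rightarrow> 'k) \<Rightarrow> 'k set
    \<Rightarrow> ('k \<Rightarrow> 'k \<Rightarrow> 'k) \<Rightarrow> ('a \<Rightarrow> (('k \<Rightarrow> 'k) \<times> ('k \<Rightarrow> 'k)) set) \<Rightarrow> 'a \<Rightarrow> 'a \<Rightarrow> 'a \<Rightarrow> 'k" where
  "Obs_rep sA sK Kc mK \<xi> =
     (let \<mu> = SOME \<mu>. bimult_law sA sK Kc mK \<xi> \<mu>;
          h = SOME h. hindrance sA sK Kc mK \<mu> h
      in obs_cocycle \<mu> h)"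

end

theory Submission
  imports Defs "HOL-Library.Product_Plus"
begin

text \<open>
  Let \<open>f\<close> be a cocycle representing \<open>c\<close>. Coinduction kills its class: the space of linear maps
  \<open>p\<close> from \<open>A\<^sup>+ = F \<oplus> A\<close> to \<open>M\<close>, with \<open>(a p)(y) = a p(y)\<close> and \<open>(p a)(y) = p(ay)\<close>, is a bimodule
  \<open>W\<close> containing \<open>M\<close> via \<open>m \<mapsto> (y \<mapsto> m y)\<close>, and there \<open>f\<close> is the coboundary of \<open>h(a, b) = - f(a, b, -)\<close>.
  As \<open>f\<close> dies in \<open>N = W / M\<close>, \<open>h\<close> induces a 2-cocycle with values in \<open>N\<close>, which twists the right
  action of \<open>A\<close> on \<open>Q = A\<^sup>+ \<oplus> N\<close> to \<open>(x, n) a = (x a, n a + h(x, a))\<close>. The defect of this action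
  being associative is \<open>q \<mapsto> q h(a, b)\<close> for the pairing \<open>(x, n) w = (0, x w)\<close> of \<open>Q\<close> with \<open>W\<close>.
  Hence \<open>F e \<oplus> Q \<oplus> W\<close>, with this pairing and a left unit \<open>e\<close> for \<open>F e \<oplus> Q\<close> as its only products,
  carries a bimultiplication law with hindrance \<open>h\<close>. The unit \<open>1 \<in> A\<^sup>+\<close> detects \<open>N\<close> and \<open>e\<close> detects
  \<open>Q\<close>, so that exactly \<open>M\<close> annihilates everything.
\<close>

section \<open>Linear, bilinear and trilinear maps\<close>

lemma linearI:
  assumes "vector_space s1" "vector_space s2"
    and "\<And>x y. g (x + y) = g x + g y" "\<And>r x. g (s1 r x) = s2 r (g x)"
  shows "Vector_Spaces.linear s1 s2 g"
  using assms
  by (simp add: Vector_Spaces.linear_def module_hom_def module_hom_axioms_def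
      module_iff_vector_space)

lemma
  assumes "Vector_Spaces.linear s1 s2 g"
  shows linear_addD: "g (x + y) = g x + g y"
    and linear_scaleD: "g (s1 r x) = s2 r (g x)"
    and linear_zeroD: "g 0 = 0"
    and linear_minusD: "g (- x) = - g x"
    and linear_diffD: "g (x - y) = g x - g y"
    and linear_vs1D: "vector_space s1"
    and linear_vs2D: "vector_space s2"
proof -
  interpret Vector_Spaces.linear s1 s2 g by fact
  show "g (x + y) = g x + g y" "g (s1 r x) = s2 r (g x)" "g 0 = 0" "g (- x) = - g x"
    "g (x - y) = g x - g y" "vector_space s1" "vector_space s2"
    by (simp_all add: add scale zero neg diff vs1.vector_space_axioms vs2.vector_space_axioms)
qed

lemma
  assumes "bilin s1 s2 s3 g"
  shows bilin_add_left: "g (x + x') y = g x y + g x' y"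
    and bilin_add_right: "g x (y + y') = g x y + g x y'"
    and bilin_scale_left: "g (s1 r x) y = s3 r (g x y)"
    and bilin_scale_right: "g x (s2 r y) = s3 r (g x y)"
    and bilin_zero_left: "g 0 y = 0"
    and bilin_zero_right: "g x 0 = 0"
    and bilin_minus_left: "g (- x) y = - g x y"
    and bilin_minus_right: "g x (- y) = - g x y"
    and bilin_diff_left: "g (x - x') y = g x y - g x' y"
    and bilin_diff_right: "g x (y - y') = g x y - g x y'"
proof -
  have R: "Vector_Spaces.linear s2 s3 (g x)" for x using assms by (simp add: bilin_def)
  have L: "Vector_Spaces.linear s1 s3 (\<lambda>x. g x y)" for y using assms by (simp add: bilin_def)
  show "g (x + x') y = g x y + g x' y" "g (s1 r x) y = s3 r (g x y)" "g 0 y = 0"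
    "g (- x) y = - g x y" "g (x - x') y = g x y - g x' y"
    using linear_addD[OF L] linear_scaleD[OF L] linear_zeroD[OF L] linear_minusD[OF L]
      linear_diffD[OF L] by blast+
  show "g x (y + y') = g x y + g x y'" "g x (s2 r y) = s3 r (g x y)" "g x 0 = 0"
    "g x (- y) = - g x y" "g x (y - y') = g x y - g x y'"
    using linear_addD[OF R] linear_scaleD[OF R] linear_zeroD[OF R] linear_minusD[OF R]
      linear_diffD[OF R] by blast+
qed

lemma bilinI:
  assumes "vector_space s1" "vector_space s2" "vector_space s3"
    and "\<And>x x' y. g (x + x') y = g x y + g x' y" "\<And>x y y'. g x (y + y') = g x y + g x y'"
    and "\<And>r x y. g (s1 r x) y = s3 r (g x y)" "\<And>r x y. g x (s2 r y) = s3 r (g x y)"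
  shows "bilin s1 s2 s3 g"
  using assms by (auto simp: bilin_def intro!: linearI)

lemma
  assumes "trilin sA sM f"
  shows trilin_add1: "f (x + x') y z = f x y z + f x' y z"
    and trilin_add2: "f x (y + y') z = f x y z + f x y' z"
    and trilin_add3: "f x y (z + z') = f x y z + f x y z'"
    and trilin_scale1: "f (sA r x) y z = sM r (f x y z)"
    and trilin_scale2: "f x (sA r y) z = sM r (f x y z)"
    and trilin_scale3: "f x y (sA r z) = sM r (f x y z)"
    and trilin_zero1: "f 0 y z = 0"
proof -
  have 1: "Vector_Spaces.linear sA sM (\<lambda>x. f x y z)" for y z using assms by (simp add: trilin_def)
  have 2: "Vector_Spaces.linear sA sM (\<lambda>y. f x y z)" for x z using assms by (simp add: trilin_def)
  have 3: "Vector_Spaces.linear sA sM (f x y)" for x y using assms by (simp add: trilin_def)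
  show "f (x + x') y z = f x y z + f x' y z" "f (sA r x) y z = sM r (f x y z)" "f 0 y z = 0"
    using linear_addD[OF 1] linear_scaleD[OF 1] linear_zeroD[OF 1] by blast+
  show "f x (y + y') z = f x y z + f x y' z" "f x (sA r y) z = sM r (f x y z)"
    using linear_addD[OF 2] linear_scaleD[OF 2] by blast+
  show "f x y (z + z') = f x y z + f x y z'" "f x y (sA r z) = sM r (f x y z)"
    using linear_addD[OF 3] linear_scaleD[OF 3] by blast+
qed

lemma trilinI:
  assumes "vector_space sA" "vector_space sM"
    and "\<And>x x' y z. f (x + x') y z = f x y z + f x' y z"
    and "\<And>x y y' z. f x (y + y') z = f x y z + f x y' z"
    and "\<And>x y z z'. f x y (z + z') = f x y z + f x y z'"
    and "\<And>r x y z. f (sA r x) y z = sM r (f x y z)"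
    and "\<And>r x y z. f x (sA r y) z = sM r (f x y z)"
    and "\<And>r x y z. f x y (sA r z) = sM r (f x y z)"
  shows "trilin sA sM f"
  using assms by (auto simp: trilin_def intro!: linearI)

section \<open>Bimodules and Hochschild cocycles\<close>

lemma bimoduleD:
  assumes "bimodule sA sM la ra"
  shows "vector_space sM" "bilin sA sM sM la" "bilin sM sA sM ra"
    "la (a * b) m = la a (la b m)" "ra m (a * b) = ra (ra m a) b"
    "ra (la a m) b = la a (ra m b)"
  using assms by (auto simp: bimodule_def)

lemma assoc_algebraD:
  assumes "assoc_algebra sA"
  shows "vector_space sA" "sA r x * y = sA r (x * y)" "x * sA r y = sA r (x * y)"
  using assms unfolding assoc_algebra_def by metis+

text \<open>\<open>hh3_class\<close> admits only cocycles as members. The terms of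
  \<open>hoch_d2\<close> cancel in the cocycle identity by associativity and the bimodule
  laws.\<close>

lemma hoch_3cocycle_add_hoch_d2:
  assumes A: "assoc_algebra sA" and B: "bimodule sA sM la ra"
    and f: "hoch_3cocycle sA sM la ra f" and g: "bilin sA sA sM g"
  shows "hoch_3cocycle sA sM la ra (\<lambda>a1 a2 a3. f a1 a2 a3 + hoch_d2 la ra g a1 a2 a3)"
proof -
  note [simp] = bimoduleD(4-6)[OF B] assoc_algebraD(2-3)[OF A]
  note l = bimoduleD(2)[OF B] and r = bimoduleD(3)[OF B]
  have t: "trilin sA sM f"
    and c: "la a1 (f a2 a3 a4) - f (a1 * a2) a3 a4 + f a1 (a2 * a3) a4
        - f a1 a2 (a3 * a4) + ra (f a1 a2 a3) a4 = 0" for a1 a2 a3 a4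
    using f by (auto simp: hoch_3cocycle_def)
  note bs = bilin_add_left bilin_add_right bilin_diff_left bilin_diff_right
  note sc = bilin_scale_left bilin_scale_right
  interpret M: vector_space sM by (rule bimoduleD(1)[OF B])
  have "trilin sA sM (\<lambda>a1 a2 a3. f a1 a2 a3 + hoch_d2 la ra g a1 a2 a3)"
    unfolding hoch_d2_def
    by (rule trilinI)
      (simp_all add: assoc_algebraD(1)[OF A] M.vector_space_axioms
        trilin_add1[OF t] trilin_add2[OF t] trilin_add3[OF t]
        trilin_scale1[OF t] trilin_scale2[OF t] trilin_scale3[OF t]
        bs[OF l] bs[OF r] bs[OF g] sc[OF l] sc[OF r] sc[OF g]
        M.scale_right_distrib M.scale_right_diff_distrib algebra_simps)
  moreover have "la a1 (f a2 a3 a4 + hoch_d2 la ra g a2 a3 a4)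
      - (f (a1 * a2) a3 a4 + hoch_d2 la ra g (a1 * a2) a3 a4)
      + (f a1 (a2 * a3) a4 + hoch_d2 la ra g a1 (a2 * a3) a4)
      - (f a1 a2 (a3 * a4) + hoch_d2 la ra g a1 a2 (a3 * a4))
      + ra (f a1 a2 a3 + hoch_d2 la ra g a1 a2 a3) a4 = 0" for a1 a2 a3 a4
    using c[of a1 a2 a3 a4]
    by (simp add: hoch_d2_def bs[OF l] bs[OF r] mult.assoc)
  ultimately show ?thesis by (simp add: hoch_3cocycle_def)
qed

section \<open>Algebras with a bimultiplication law of prescribed obstruction\<close>

text \<open>The conditions on \<open>u\<close> and \<open>v\<close> concern \<open>K\<close> only,
  and the same list serves the explicit extension and its image in the function space. As
  \<open>u\<close> is multiplicative, the left component of the curvature vanishes; hence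
  \<open>h_mult\<close>.\<close>

locale obstruction_datum =
  fixes sA :: "'f::field \<Rightarrow> 'a::ring \<Rightarrow> 'a"
    and sM :: "'f \<Rightarrow> 'm::ab_group_add \<Rightarrow> 'm"
    and la :: "'a \<Rightarrow> 'm \<Rightarrow> 'm" and ra :: "'m \<Rightarrow> 'a \<Rightarrow> 'm"
    and f :: "'a \<Rightarrow> 'a \<Rightarrow> 'a \<Rightarrow> 'm"
    and sK :: "'f \<Rightarrow> 'k::ab_group_add \<Rightarrow> 'k" and K :: "'k set"
    and mK :: "'k \<Rightarrow> 'k \<Rightarrow> 'k" and \<iota> :: "'m \<Rightarrow> 'k"
    and u v :: "'a \<Rightarrow> 'k \<Rightarrow> 'k" and h :: "'a \<Rightarrow> 'a \<Rightarrow> 'k"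
  assumes algA: "assoc_algebra sA"
    and bimod: "bimodule sA sM la ra"
    and cocycle: "hoch_3cocycle sA sM la ra f"
    and algK: "algebra_on sK K mK"
    and u_closed: "x \<in> K \<Longrightarrow> u a x \<in> K" and v_closed: "x \<in> K \<Longrightarrow> v a x \<in> K"
    and u_add: "x \<in> K \<Longrightarrow> y \<in> K \<Longrightarrow> u a (x + y) = u a x + u a y"
    and v_add: "x \<in> K \<Longrightarrow> y \<in> K \<Longrightarrow> v a (x + y) = v a x + v a y"
    and u_scale: "x \<in> K \<Longrightarrow> u a (sK r x) = sK r (u a x)"
    and v_scale: "x \<in> K \<Longrightarrow> v a (sK r x) = sK r (v a x)"
    and u_add_left: "x \<in> K \<Longrightarrow> u (a + b) x = u a x + u b x"
    and v_add_left: "x \<in> K \<Longrightarrow> v (a + b) x = v a x + v b x"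
    and u_scale_left: "x \<in> K \<Longrightarrow> u (sA r a) x = sK r (u a x)"
    and v_scale_left: "x \<in> K \<Longrightarrow> v (sA r a) x = sK r (v a x)"
    and mult_u: "x \<in> K \<Longrightarrow> y \<in> K \<Longrightarrow> mK x (u a y) = mK (v a x) y"
    and u_mult: "x \<in> K \<Longrightarrow> y \<in> K \<Longrightarrow> u a (mK x y) = mK (u a x) y"
    and v_mult: "x \<in> K \<Longrightarrow> y \<in> K \<Longrightarrow> v a (mK x y) = mK x (v a y)"
    and u_v: "x \<in> K \<Longrightarrow> u a (v b x) = v b (u a x)"
    and u_times: "x \<in> K \<Longrightarrow> u (a * b) x = u a (u b x)"
    and v_v: "x \<in> K \<Longrightarrow> v b (v a x) = v (a * b) x + mK x (h a b)"
    and h_closed: "h a b \<in> K" and h_bilin: "bilin sA sA sK h"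
    and h_mult: "x \<in> K \<Longrightarrow> mK (h a b) x = 0"
    and \<iota>_linear: "Vector_Spaces.linear sM sK \<iota>" and \<iota>_inj: "inj \<iota>"
    and anni: "Anni K mK = range \<iota>"
    and u_\<iota>: "u a (\<iota> m) = \<iota> (la a m)" and v_\<iota>: "v a (\<iota> m) = \<iota> (ra m a)"
    and obs: "u a1 (h a2 a3) - h (a1 * a2) a3 + h a1 (a2 * a3) - v a3 (h a1 a2)
               = \<iota> (f a1 a2 a3)"
begin

sublocale A: vector_space sA by (rule assoc_algebraD(1)[OF algA])
sublocale M: vector_space sM by (rule bimoduleD(1)[OF bimod])
sublocale K: vector_space sK using algK by (simp add: algebra_on_def)

lemma
  shows zero_closed: "0 \<in> K"
    and add_closed: "x \<in> K \<Longrightarrow> y \<in> K \<Longrightarrow> x + y \<in> K"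
    and mult_closed: "x \<in> K \<Longrightarrow> y \<in> K \<Longrightarrow> mK x y \<in> K"
    and scale_closed: "x \<in> K \<Longrightarrow> sK r x \<in> K"
    and mult_add_left: "x \<in> K \<Longrightarrow> y \<in> K \<Longrightarrow> z \<in> K \<Longrightarrow> mK (x + y) z = mK x z + mK y z"
    and mult_add_right: "x \<in> K \<Longrightarrow> y \<in> K \<Longrightarrow> z \<in> K \<Longrightarrow> mK z (x + y) = mK z x + mK z y"
    and mult_scale_left: "x \<in> K \<Longrightarrow> y \<in> K \<Longrightarrow> mK (sK r x) y = sK r (mK x y)"
    and mult_scale_right: "x \<in> K \<Longrightarrow> y \<in> K \<Longrightarrow> mK x (sK r y) = sK r (mK x y)"
    and mult_assoc: "x \<in> K \<Longrightarrow> y \<in> K \<Longrightarrow> z \<in> K \<Longrightarrow> mK (mK x y) z = mK x (mK y z)"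
  using algK by (auto simp: algebra_on_def)

lemma minus_closed: "x \<in> K \<Longrightarrow> - x \<in> K"
  using scale_closed[of x "-1"] by simp

lemma diff_closed: "x \<in> K \<Longrightarrow> y \<in> K \<Longrightarrow> x - y \<in> K"
  using add_closed[of x "- y"] minus_closed[of y] by simp

lemma u_minus: "x \<in> K \<Longrightarrow> u a (- x) = - u a x"
  using u_scale[of x a "-1"] by simp

lemma v_minus: "x \<in> K \<Longrightarrow> v a (- x) = - v a x"
  using v_scale[of x a "-1"] by simp

lemma u_diff: "x \<in> K \<Longrightarrow> y \<in> K \<Longrightarrow> u a (x - y) = u a x - u a y"
  using u_add[of x "- y" a] by (simp add: u_minus minus_closed)

lemma v_diff: "x \<in> K \<Longrightarrow> y \<in> K \<Longrightarrow> v a (x - y) = v a x - v a y"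
  using v_add[of x "- y" a] by (simp add: v_minus minus_closed)

lemma mult_minus_left: "x \<in> K \<Longrightarrow> y \<in> K \<Longrightarrow> mK (- x) y = - mK x y"
  using mult_scale_left[of x y "-1"] by simp

lemma mult_minus_right: "x \<in> K \<Longrightarrow> y \<in> K \<Longrightarrow> mK x (- y) = - mK x y"
  using mult_scale_right[of x y "-1"] by simp

lemma mult_diff_left: "x \<in> K \<Longrightarrow> y \<in> K \<Longrightarrow> z \<in> K \<Longrightarrow> mK (x - y) z = mK x z - mK y z"
  using mult_add_left[of x "- y" z] by (simp add: mult_minus_left minus_closed)

lemma mult_diff_right: "x \<in> K \<Longrightarrow> y \<in> K \<Longrightarrow> z \<in> K \<Longrightarrow> mK z (x - y) = mK z x - mK z y"
  using mult_add_right[of x "- y" z] by (simp add: mult_minus_right minus_closed)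

lemma mult_zero_left: "x \<in> K \<Longrightarrow> mK 0 x = 0"
  using mult_scale_left[of x x 0] by simp

lemma mult_zero_right: "x \<in> K \<Longrightarrow> mK x 0 = 0"
  using mult_scale_right[of x x 0] by simp

lemma u_zero: "u a 0 = 0"
  using u_scale[OF zero_closed, of a 0] by simp

lemma v_zero: "v a 0 = 0"
  using v_scale[OF zero_closed, of a 0] by simp

lemma \<iota>_closed: "\<iota> m \<in> K"
  and \<iota>_mult: "x \<in> K \<Longrightarrow> mK (\<iota> m) x = 0"
  and mult_\<iota>: "x \<in> K \<Longrightarrow> mK x (\<iota> m) = 0"
  using anni by (auto simp: Anni_def)

lemmas closed = zero_closed add_closed mult_closed scale_closed minus_closed diff_closed
  u_closed v_closed h_closed \<iota>_closed

section \<open>The bimultiplication law and its coupling\<close>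

text \<open>\<open>klin\<close> requires the value 0 outside \<open>K\<close>, where
  \<open>u\<close> and \<open>v\<close> are unconstrained.\<close>

definition \<mu> :: "'a \<Rightarrow> ('k \<Rightarrow> 'k) \<times> ('k \<Rightarrow> 'k)" where
  "\<mu> a = (\<lambda>k. if k \<in> K then u a k else 0, \<lambda>k. if k \<in> K then v a k else 0)"

definition \<xi> :: "'a \<Rightarrow> (('k \<Rightarrow> 'k) \<times> ('k \<Rightarrow> 'k)) set" where
  "\<xi> a = natproj K mK (\<mu> a)"

lemma \<mu>_Mul: "\<mu> a \<in> Mul sK K mK"
  by (simp add: \<mu>_def Mul_def klin_def closed u_add v_add u_scale v_scale mult_u u_mult v_mult)

lemma \<mu>_add: "\<mu> (a + b) = mul_add (\<mu> a) (\<mu> b)"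
  by (auto simp: \<mu>_def mul_add_def fun_eq_iff u_add_left v_add_left)

lemma \<mu>_scale: "\<mu> (sA r a) = mul_scale sK r (\<mu> a)"
  by (auto simp: \<mu>_def mul_scale_def fun_eq_iff u_scale_left v_scale_left)

lemma bimult_law_\<mu>: "bimult_law sA sK K mK \<xi> \<mu>"
  unfolding bimult_law_def
  by (auto simp: \<mu>_Mul \<mu>_add \<mu>_scale \<xi>_def) (simp add: \<mu>_def closed u_v)

lemma eps_add: "x \<in> K \<Longrightarrow> y \<in> K \<Longrightarrow> eps K mK (x + y) = mul_add (eps K mK x) (eps K mK y)"
  by (auto simp: eps_def mul_add_def fun_eq_iff mult_add_left mult_add_right)

lemma eps_scale: "x \<in> K \<Longrightarrow> eps K mK (sK r x) = mul_scale sK r (eps K mK x)"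
  by (auto simp: eps_def mul_scale_def fun_eq_iff mult_scale_left mult_scale_right)

text \<open>\<open>Inn\<close> absorbs inner summands, being closed under sums and differences. This
  makes the \<open>SOME\<close> representatives in \<open>out_add\<close>, \<open>out_scale\<close>
  and \<open>out_mult\<close> harmless.\<close>

lemma natproj_mul_add_eps:
  assumes "x \<in> K"
  shows "natproj K mK (mul_add p (eps K mK x)) = natproj K mK p"
proof (intro equalityI subsetI)
  fix q assume "q \<in> natproj K mK (mul_add p (eps K mK x))"
  then obtain y where y: "y \<in> K" "q = mul_add (mul_add p (eps K mK x)) (eps K mK y)"
    by (auto simp: natproj_def Inn_def)
  then have "q = mul_add p (eps K mK (x + y))"
    using assms by (simp add: eps_add mul_add_def add.assoc)
  then show "q \<in> natproj K mK p" using assms y by (auto simp: natproj_def Inn_def closed)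
next
  fix q assume "q \<in> natproj K mK p"
  then obtain y where y: "y \<in> K" "q = mul_add p (eps K mK y)"
    by (auto simp: natproj_def Inn_def)
  have "eps K mK y = mul_add (eps K mK x) (eps K mK (y - x))"
    using assms y by (simp add: closed flip: eps_add)
  then have "q = mul_add (mul_add p (eps K mK x)) (eps K mK (y - x))"
    using y by (simp add: mul_add_def add.assoc)
  then show "q \<in> natproj K mK (mul_add p (eps K mK x))"
    using assms y by (auto simp: natproj_def Inn_def closed)
qed

lemma mem_natproj_self: "p \<in> natproj K mK p"
proof -
  have "p = mul_add p (eps K mK 0)"
    by (auto simp: mul_add_def eps_def mult_zero_left mult_zero_right fun_eq_iff
        intro!: prod_eqI)
  then show ?thesis by (auto simp: natproj_def Inn_def closed)
qed

lemma some_\<xi>: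
  obtains k where "k \<in> K" "(SOME x. x \<in> \<xi> a) = mul_add (\<mu> a) (eps K mK k)"
proof -
  have "(SOME x. x \<in> \<xi> a) \<in> \<xi> a" 
    unfolding \<xi>_def using mem_natproj_self by (rule someI)
  then show ?thesis using that by (auto simp: \<xi>_def natproj_def Inn_def)
qed

text \<open>On the left, \<open>u_mult\<close> and \<open>mult_u\<close> turn the mixed terms into
  multiplication by \<open>u a l\<close> and \<open>v b k\<close>; on the right,
  \<open>mult_u\<close> and \<open>v_mult\<close> do so. There \<open>v_v\<close> contributes
  \<open>h a b\<close>, which is invisible on the left by \<open>h_mult\<close>.\<close>

lemma mul_prod_perturbed:
  assumes "k \<in> K" "l \<in> K"
  shows "mul_prod (mul_add (\<mu> a) (eps K mK k)) (mul_add (\<mu> b) (eps K mK l)) =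
    mul_add (\<mu> (a * b)) (eps K mK (h a b + u a l + v b k + mK k l))"
  using assms
  by (auto simp: mul_prod_def mul_add_def eps_def \<mu>_def fun_eq_iff closed mult_add_left
      mult_add_right u_add v_add h_mult u_times v_v mult_u u_mult v_mult mult_assoc
      u_zero v_zero mult_zero_left mult_zero_right algebra_simps)

lemma coupling_\<xi>: "coupling sA sK K mK \<xi>"
  unfolding coupling_def
proof (intro conjI allI)
  fix a b r
  show "\<xi> a \<in> Out sK K mK" using \<mu>_Mul by (auto simp: \<xi>_def Out_def)
  obtain k where k: "k \<in> K" "(SOME x. x \<in> \<xi> a) = mul_add (\<mu> a) (eps K mK k)" by (rule some_\<xi>)
  obtain l where l: "l \<in> K" "(SOME x. x \<in> \<xi> b) = mul_add (\<mu> b) (eps K mK l)" by (rule some_\<xi>)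
  have "mul_add (mul_add (\<mu> a) (eps K mK k)) (mul_add (\<mu> b) (eps K mK l))
      = mul_add (\<mu> (a + b)) (eps K mK (k + l))"
    using k l by (simp add: eps_add \<mu>_add) (simp add: mul_add_def algebra_simps)
  then show "\<xi> (a + b) = out_add K mK (\<xi> a) (\<xi> b)"
    using k l by (simp add: out_add_def natproj_mul_add_eps closed) (simp add: \<xi>_def)
  have "mul_scale sK r (mul_add (\<mu> a) (eps K mK k)) = mul_add (\<mu> (sA r a)) (eps K mK (sK r k))"
    using k by (simp add: eps_scale \<mu>_scale)
      (simp add: mul_add_def mul_scale_def K.scale_right_distrib)
  then show "\<xi> (sA r a) = out_scale sK K mK r (\<xi> a)"
    using k by (simp add: out_scale_def natproj_mul_add_eps closed) (simp add: \<xi>_def)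
  show "\<xi> (a * b) = out_mult K mK (\<xi> a) (\<xi> b)"
    using k l by (simp add: out_mult_def mul_prod_perturbed natproj_mul_add_eps closed)
      (simp add: \<xi>_def)
qed

section \<open>Independence of the law and of the hindrance\<close>

text \<open>A linear choice of \<open>\<nu>\<close> is made on a basis of \<open>A\<close>.\<close>
lemma bimult_law_perturbation:
  assumes "bimult_law sA sK K mK \<xi> \<mu>'"
  obtains \<nu> where "Vector_Spaces.linear sA sK \<nu>" "\<And>a. \<nu> a \<in> K"
    "\<And>a. \<mu>' a = mul_add (\<mu> a) (eps K mK (\<nu> a))"
proof -
  interpret P: vector_space_pair sA sK ..
  define B where "B = A.extend_basis {}"
  have B: "A.independent B" "A.span B = UNIV"
    using A.independent_extend_basis[of "{}"] A.span_extend_basis[of "{}"]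
    by (auto simp: B_def A.independent_empty)
  have "\<exists>k\<in>K. \<mu>' a = mul_add (\<mu> a) (eps K mK k)" for a
  proof -
    have "natproj K mK (\<mu>' a) = natproj K mK (\<mu> a)"
      using assms by (simp add: bimult_law_def \<xi>_def)
    then have "\<mu>' a \<in> natproj K mK (\<mu> a)" using mem_natproj_self[of "\<mu>' a"] by simp
    then show ?thesis by (auto simp: natproj_def Inn_def)
  qed
  then obtain \<kappa> where \<kappa>: "\<And>a. \<kappa> a \<in> K" "\<And>a. \<mu>' a = mul_add (\<mu> a) (eps K mK (\<kappa> a))"
    by metis
  obtain \<nu> where \<nu>: "Vector_Spaces.linear sA sK \<nu>" "\<And>b. b \<in> B \<Longrightarrow> \<nu> b = \<kappa> b"
    using P.linear_independent_extend[OF B(1)] by blast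
  have add: "\<mu>' (a + b) = mul_add (\<mu>' a) (\<mu>' b)" and scale: "\<mu>' (sA r a) = mul_scale sK r (\<mu>' a)"
    for a b r using assms by (auto simp: bimult_law_def)
  \<comment> \<open>The linear extension only takes values in the whole type, so membership in
    \<open>K\<close> is proved along with the equation, by induction over the span of
    \<open>B\<close>.\<close>
  have "\<nu> a \<in> K \<and> \<mu>' a = mul_add (\<mu> a) (eps K mK (\<nu> a))" for a
  proof -
    have "a \<in> A.span B" using B by simp
    then show ?thesis
    proof (induct rule: A.span_induct_alt)
      case base
      have "\<mu>' 0 = mul_scale sK 0 (\<mu>' 0)" "\<mu> 0 = mul_scale sK 0 (\<mu> 0)"
        using scale[of 0 0] \<mu>_scale[of 0 0] by simp_all
      then have "\<mu>' 0 = \<mu> 0" by (simp add: mul_scale_def)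
      then show ?case using eps_scale[OF zero_closed, of 0]
        by (simp add: linear_zeroD[OF \<nu>(1)] closed mul_add_def mul_scale_def)
    next
      case (step r x y)
      have x: "\<nu> x \<in> K" "\<mu>' x = mul_add (\<mu> x) (eps K mK (\<nu> x))"
        using \<kappa>[of x] \<nu>(2)[OF step(1)] by simp_all
      show ?case
        using x(1) step(2)
        by (simp add: add scale x(2) linear_addD[OF \<nu>(1)] linear_scaleD[OF \<nu>(1)] closed
            \<mu>_add \<mu>_scale eps_add eps_scale)
          (simp add: mul_add_def mul_scale_def K.scale_right_distrib algebra_simps)
    qed
  qed
  then show ?thesis using that \<nu>(1) by blast
qed

text \<open>The formula is that of \<open>mul_prod_perturbed\<close>, less
  \<open>\<nu> (a * b)\<close> for the inner part of \<open>\<mu>' (a * b)\<close>.\<close>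

lemma hindrance_perturbed:
  assumes \<nu>: "Vector_Spaces.linear sA sK \<nu>" "\<And>a. \<nu> a \<in> K"
    and \<mu>': "\<And>a. \<mu>' a = mul_add (\<mu> a) (eps K mK (\<nu> a))"
  shows "hindrance sA sK K mK \<mu>'
    (\<lambda>a b. h a b + u a (\<nu> b) + v b (\<nu> a) + mK (\<nu> a) (\<nu> b) - \<nu> (a * b))"
proof -
  note ls = linear_addD[OF \<nu>(1)] linear_scaleD[OF \<nu>(1)]
    and hs = bilin_add_left[OF h_bilin] bilin_add_right[OF h_bilin]
      bilin_scale_left[OF h_bilin] bilin_scale_right[OF h_bilin]
    and As = assoc_algebraD(2,3)[OF algA]
  let ?h = "\<lambda>a b. h a b + u a (\<nu> b) + v b (\<nu> a) + mK (\<nu> a) (\<nu> b) - \<nu> (a * b)"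
  have "bilin sA sA sK ?h"
    by (rule bilinI)
      (simp_all add: ls hs As \<nu> closed A.vector_space_axioms K.vector_space_axioms u_add v_add
        u_scale v_scale u_add_left v_add_left u_scale_left v_scale_left mult_add_left
        mult_add_right mult_scale_left mult_scale_right K.scale_right_distrib
        K.scale_right_diff_distrib algebra_simps)
  moreover have "eps K mK (?h a b) = curvature \<mu>' a b" for a b
    unfolding curvature_def \<mu>' mul_prod_perturbed[OF \<nu>(2) \<nu>(2)]
    using \<nu>(2)
    by (auto simp: eps_def mul_diff_def mul_add_def fun_eq_iff closed mult_diff_left mult_diff_right)
  ultimately show ?thesis using \<nu>(2) by (simp add: hindrance_def closed)
qed

text \<open>All terms in \<nu> cancel, with no coboundary left over:
  \<open>mK (\<nu> a1) (h a2 a3)\<close> meets the defect from \<open>v_v\<close>, and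
  \<open>mK (h a1 a2) (\<nu> a3)\<close> is zero by \<open>h_mult\<close>.\<close>

lemma obs_cocycle_perturbed:
  assumes \<nu>: "\<And>a. \<nu> a \<in> K"
    and \<mu>': "\<And>a. \<mu>' a = mul_add (\<mu> a) (eps K mK (\<nu> a))"
  shows "obs_cocycle \<mu>' (\<lambda>a b. h a b + u a (\<nu> b) + v b (\<nu> a) + mK (\<nu> a) (\<nu> b) - \<nu> (a * b)) a1 a2 a3
    = \<iota> (f a1 a2 a3)"
  using \<nu>
  by (simp add: obs_cocycle_def \<mu>' mul_add_def \<mu>_def eps_def closed u_add v_add u_diff v_diff
      mult_add_left mult_add_right mult_diff_left mult_diff_right h_mult u_times v_v
      mult_u u_mult v_mult u_v mult_assoc mult.assoc flip: obs)

text \<open>The kernel of \<open>eps\<close> on \<open>K\<close> is the annihilator, that is, the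
  range of \<iota>. Injectivity of \<iota> carries bilinearity over to \<open>g\<close>.\<close>

lemma hindrance_diff:
  assumes h1: "hindrance sA sK K mK \<mu>' h1" and h2: "hindrance sA sK K mK \<mu>' h2"
  obtains g where "bilin sA sA sM g" "\<And>a b. h2 a b = h1 a b + \<iota> (g a b)"
proof -
  note b1 = h1[unfolded hindrance_def, THEN conjunct2, THEN conjunct1]
  note b2 = h2[unfolded hindrance_def, THEN conjunct2, THEN conjunct1]
  have "h2 a b - h1 a b \<in> Anni K mK" for a b
  proof -
    have cl: "h1 a b \<in> K" "h2 a b \<in> K" and e: "eps K mK (h1 a b) = eps K mK (h2 a b)"
      using h1 h2 by (auto simp: hindrance_def)
    have "mK (h1 a b) x = mK (h2 a b) x \<and> mK x (h1 a b) = mK x (h2 a b)" if "x \<in> K" for x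
      using e that by (auto simp: eps_def dest!: fun_cong[of _ _ x])
    then show ?thesis using cl by (simp add: Anni_def closed mult_diff_left mult_diff_right)
  qed
  then have "\<exists>m. h2 a b - h1 a b = \<iota> m" for a b by (auto simp: anni)
  then obtain g where g: "\<And>a b. h2 a b - h1 a b = \<iota> (g a b)" by metis
  have inj: "x = y" if "\<iota> x = \<iota> y" for x y using \<iota>_inj that by (auto dest: injD)
  have "bilin sA sA sM g"
    by (rule bilinI; (rule inj)?)
      (simp_all add: A.vector_space_axioms M.vector_space_axioms linear_addD[OF \<iota>_linear]
        linear_scaleD[OF \<iota>_linear] bilin_add_left[OF b1] bilin_add_right[OF b1]
        bilin_scale_left[OF b1] bilin_scale_right[OF b1] bilin_add_left[OF b2]
        bilin_add_right[OF b2] bilin_scale_left[OF b2] bilin_scale_right[OF b2]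
        K.scale_right_diff_distrib flip: g)
  moreover have "h2 a b = h1 a b + \<iota> (g a b)" for a b using g[of a b] by (simp add: algebra_simps)
  ultimately show ?thesis using that by blast
qed

text \<open>Whatever \<open>Obs_rep\<close> chooses, the change of law leaves the cocycle
  \<open>f\<close> intact and the change of hindrance adds a coboundary.\<close>

lemma Obs_rep_\<xi>:
  "\<exists>z\<in>hh3_class sA sM la ra f. \<forall>a1 a2 a3. Obs_rep sA sK K mK \<xi> a1 a2 a3 = \<iota> (z a1 a2 a3)"
proof -
  define \<mu>' where "\<mu>' = (SOME \<mu>. bimult_law sA sK K mK \<xi> \<mu>)"
  define h' where "h' = (SOME h. hindrance sA sK K mK \<mu>' h)"
  have "bimult_law sA sK K mK \<xi> \<mu>'"
    unfolding \<mu>'_def by (rule someI[of "bimult_law sA sK K mK \<xi>", OF bimult_law_\<mu>])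
  then obtain \<nu> where \<nu>: "Vector_Spaces.linear sA sK \<nu>" "\<And>a. \<nu> a \<in> K"
    "\<And>a. \<mu>' a = mul_add (\<mu> a) (eps K mK (\<nu> a))"
    using bimult_law_perturbation by blast
  \<comment> \<open>A hindrance of \<open>\<mu>'\<close> whose cocycle is exactly \<open>f\<close>;
    it shows that the choice of \<open>h'\<close> is not vacuous and is what \<open>h'\<close> is
    compared with.\<close>
  define h1 where "h1 = (\<lambda>a b. h a b + u a (\<nu> b) + v b (\<nu> a) + mK (\<nu> a) (\<nu> b) - \<nu> (a * b))"
  have h1: "hindrance sA sK K mK \<mu>' h1" unfolding h1_def by (rule hindrance_perturbed[OF \<nu>])
  have "hindrance sA sK K mK \<mu>' h'"
    unfolding h'_def by (rule someI[of "hindrance sA sK K mK \<mu>'", OF h1])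
  then obtain g where g: "bilin sA sA sM g" "\<And>a b. h' a b = h1 a b + \<iota> (g a b)"
    using hindrance_diff[OF h1] by blast
  let ?z = "\<lambda>a1 a2 a3. f a1 a2 a3 + hoch_d2 la ra g a1 a2 a3"
  have "?z \<in> hh3_class sA sM la ra f"
    using hoch_3cocycle_add_hoch_d2[OF algA bimod cocycle g(1)] g(1) by (auto simp: hh3_class_def)
  moreover have "Obs_rep sA sK K mK \<xi> a1 a2 a3 = \<iota> (?z a1 a2 a3)" for a1 a2 a3
  proof -
    have cl: "h1 a b \<in> K" for a b using h1 by (simp add: hindrance_def)
    have "Obs_rep sA sK K mK \<xi> a1 a2 a3 = obs_cocycle \<mu>' h' a1 a2 a3"
      by (simp add: Obs_rep_def \<mu>'_def h'_def Let_def)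
    also have "\<dots> = obs_cocycle \<mu>' h1 a1 a2 a3 + \<iota> (hoch_d2 la ra g a1 a2 a3)"
      by (simp add: obs_cocycle_def hoch_d2_def g(2) \<nu>(2,3) mul_add_def \<mu>_def eps_def closed cl
          u_add v_add mult_add_left mult_add_right \<iota>_mult mult_\<iota> u_\<iota> v_\<iota>
          linear_addD[OF \<iota>_linear] linear_diffD[OF \<iota>_linear])
    also have "obs_cocycle \<mu>' h1 a1 a2 a3 = \<iota> (f a1 a2 a3)"
      unfolding h1_def by (rule obs_cocycle_perturbed[OF \<nu>(2,3)])
    finally show ?thesis by (simp add: linear_addD[OF \<iota>_linear])
  qed
  ultimately show ?thesis by (intro bexI[of _ ?z]) simp_all
qed

lemma fst_\<mu>_times: "fst (\<mu> (a * b)) = fst (\<mu> a) \<circ> fst (\<mu> b)"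
  by (auto simp: \<mu>_def fun_eq_iff closed u_times u_zero)

lemma \<mu>_\<iota>: "fst (\<mu> a) (\<iota> m) = \<iota> (la a m)" "snd (\<mu> a) (\<iota> m) = \<iota> (ra m a)"
  by (simp_all add: \<mu>_def closed u_\<iota> v_\<iota>)

section \<open>Transport along linear injections\<close>

lemma transport:
  fixes \<Phi> :: "'k \<Rightarrow> 'l::ab_group_add"
  assumes lin: "Vector_Spaces.linear sK sL \<Phi>" and inj: "inj \<Phi>"
  shows "obstruction_datum sA sM la ra f sL (\<Phi> ` K) (\<lambda>x y. \<Phi> (mK (inv \<Phi> x) (inv \<Phi> y)))
    (\<lambda>m. \<Phi> (\<iota> m)) (\<lambda>a x. \<Phi> (u a (inv \<Phi> x))) (\<lambda>a x. \<Phi> (v a (inv \<Phi> x))) (\<lambda>a b. \<Phi> (h a b))"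
proof -
  interpret L: vector_space sL by (rule linear_vs2D[OF lin])
  note [simp] = inv_f_f[OF inj]
  have add: "\<Phi> x + \<Phi> y = \<Phi> (x + y)" and scale: "sL r (\<Phi> x) = \<Phi> (sK r x)" for x y r
    by (simp_all add: linear_addD[OF lin] linear_scaleD[OF lin])
  have diff: "\<Phi> x - \<Phi> y = \<Phi> (x - y)" for x y by (simp add: linear_diffD[OF lin])
  \<comment> \<open>Safe for unfolding in this direction, as the two zeros have different
    types.\<close>
  have zero: "0 = \<Phi> 0" by (simp add: linear_zeroD[OF lin])
  have eq: "\<Phi> x = \<Phi> y \<longleftrightarrow> x = y" for x y using inj by (auto dest: injD)
  have mem: "\<Phi> x \<in> \<Phi> ` K \<longleftrightarrow> x \<in> K" for x by (simp add: inj_image_mem_iff[OF inj])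
  let ?m = "\<lambda>x y. \<Phi> (mK (inv \<Phi> x) (inv \<Phi> y))"
  have "algebra_on sL (\<Phi> ` K) ?m"
    unfolding algebra_on_def zero ball_simps
    by (simp add: add scale eq mem closed L.vector_space_axioms mult_add_left mult_add_right
        mult_scale_left mult_scale_right mult_assoc)
  moreover have "Anni (\<Phi> ` K) ?m = range (\<lambda>m. \<Phi> (\<iota> m))"
  proof -
    have "Anni (\<Phi> ` K) ?m = \<Phi> ` Anni K mK"
      unfolding Anni_def zero by (auto simp: eq mem)
    then show ?thesis by (simp add: anni image_image)
  qed
  moreover have "bilin sA sA sL (\<lambda>a b. \<Phi> (h a b))"
    by (rule bilinI)
      (simp_all add: A.vector_space_axioms L.vector_space_axioms add scale
        bilin_add_left[OF h_bilin] bilin_add_right[OF h_bilin]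
        bilin_scale_left[OF h_bilin] bilin_scale_right[OF h_bilin])
  moreover have "Vector_Spaces.linear sM sL (\<lambda>m. \<Phi> (\<iota> m))"
    by (rule linearI)
      (simp_all add: M.vector_space_axioms L.vector_space_axioms add scale
        linear_addD[OF \<iota>_linear] linear_scaleD[OF \<iota>_linear])
  moreover have "inj (\<lambda>m. \<Phi> (\<iota> m))" using inj \<iota>_inj by (auto simp: inj_def)
  ultimately show ?thesis
    by (intro obstruction_datum.intro)
      (auto simp: algA bimod cocycle closed add scale diff eq mem u_add v_add u_scale v_scale
        u_add_left v_add_left u_scale_left v_scale_left mult_u u_mult v_mult u_v u_times v_v
        h_mult u_\<iota> v_\<iota> obs linear_zeroD[OF lin])
qed

end

section \<open>Coordinates of a vector space\<close>

text \<open>Coordinates in a basis; the basis lies in the space, whose type can therefore index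
  them.\<close>

lemma ex_linear_inj_into_functions:
  fixes s :: "'f::field \<Rightarrow> 'm::ab_group_add \<Rightarrow> 'm"
  assumes "vector_space s"
  obtains g :: "'m \<Rightarrow> 'm \<Rightarrow> 'f"
  where "\<And>x y i. g (x + y) i = g x i + g y i" "\<And>r x i. g (s r x) i = r * g x i" "inj g"
proof -
  interpret vector_space s by fact
  define B where "B = extend_basis {}"
  have B: "independent B" "span B = UNIV"
    using independent_extend_basis[of "{}"] span_extend_basis[of "{}"]
    by (auto simp: B_def independent_empty)
  have "inj (representation B)"
  proof (rule injI)
    fix x y assume eq: "representation B x = representation B y"
    have rep: "(\<Sum>b | representation B z b \<noteq> 0. s (representation B z b) b) = z" for z
      by (rule sum_nonzero_representation_eq) (simp_all add: B)
    show "x = y" using rep[of x] rep[of y] unfolding eq by (rule trans[OF sym])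
  qed
  moreover have "representation B (x + y) i = representation B x i + representation B y i"
    "representation B (s r x) i = r * representation B x i" for x y r i
    using representation_add[of B y x] representation_scale[of B x r] B by simp_all
  ultimately show ?thesis using that by blast
qed

section \<open>The extension built from a cocycle\<close>

text \<open>
  In \<open>(e, \<beta>, x, n, m, p)\<close> the entries \<open>e\<close>, \<open>(\<beta>, x, n)\<close> and \<open>(m, p)\<close> are the parts in \<open>F e\<close>, \<open>Q\<close> and \<open>W\<close>.
  \<open>N\<close> is identified with the linear maps \<open>A \<rightarrow> M\<close>, and \<open>(m, p)\<close> stands for the map on \<open>A\<^sup>+\<close> that sends
  \<open>1\<close> to \<open>m\<close> and \<open>y \<in> A\<close> to \<open>m y + p y\<close>; this accounts for the terms \<open>ra (p a) y\<close> below.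
\<close>
type_synonym ('f, 'a, 'm) extension =
  "'f \<times> 'f \<times> 'a \<times> ('a \<Rightarrow> 'm) \<times> 'm \<times> ('a \<Rightarrow> 'm)"

locale cocycle_datum =
  fixes sA :: "'f::field \<Rightarrow> 'a::ring \<Rightarrow> 'a"
    and sM :: "'f \<Rightarrow> 'm::ab_group_add \<Rightarrow> 'm"
    and la :: "'a \<Rightarrow> 'm \<Rightarrow> 'm" and ra :: "'m \<Rightarrow> 'a \<Rightarrow> 'm"
    and f :: "'a \<Rightarrow> 'a \<Rightarrow> 'a \<Rightarrow> 'm"
  assumes algA: "assoc_algebra sA"
    and bimod: "bimodule sA sM la ra"
    and cocycle: "hoch_3cocycle sA sM la ra f"
begin

sublocale A: vector_space sA by (rule assoc_algebraD(1)[OF algA])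
sublocale M: vector_space sM by (rule bimoduleD(1)[OF bimod])

lemma trilin_f: "trilin sA sM f"
  using cocycle by (simp add: hoch_3cocycle_def)

text \<open>The cocycle identity as a rewrite rule that removes \<open>la\<close> in front of
  \<open>f\<close>.\<close>

lemma la_f: "la a1 (f a2 a3 a4) =
    f (a1 * a2) a3 a4 - f a1 (a2 * a3) a4 + f a1 a2 (a3 * a4) - ra (f a1 a2 a3) a4"
proof -
  have "la a1 (f a2 a3 a4) - f (a1 * a2) a3 a4 + f a1 (a2 * a3) a4
        - f a1 a2 (a3 * a4) + ra (f a1 a2 a3) a4 = 0"
    using cocycle by (simp add: hoch_3cocycle_def)
  then show ?thesis by (simp add: algebra_simps)
qed

lemmas la_simps = bilin_add_left[OF bimoduleD(2)[OF bimod]] bilin_add_right[OF bimoduleD(2)[OF bimod]]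
  bilin_diff_right[OF bimoduleD(2)[OF bimod]] bilin_minus_right[OF bimoduleD(2)[OF bimod]]
  bilin_scale_left[OF bimoduleD(2)[OF bimod]] bilin_scale_right[OF bimoduleD(2)[OF bimod]]
  bilin_zero_left[OF bimoduleD(2)[OF bimod]] bilin_zero_right[OF bimoduleD(2)[OF bimod]]
lemmas ra_simps = bilin_add_left[OF bimoduleD(3)[OF bimod]] bilin_add_right[OF bimoduleD(3)[OF bimod]]
  bilin_diff_left[OF bimoduleD(3)[OF bimod]] bilin_minus_left[OF bimoduleD(3)[OF bimod]]
  bilin_scale_left[OF bimoduleD(3)[OF bimod]] bilin_scale_right[OF bimoduleD(3)[OF bimod]]
  bilin_zero_left[OF bimoduleD(3)[OF bimod]] bilin_zero_right[OF bimoduleD(3)[OF bimod]]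
lemmas f_simps = trilin_add1[OF trilin_f] trilin_add2[OF trilin_f] trilin_add3[OF trilin_f]
  trilin_scale1[OF trilin_f] trilin_scale2[OF trilin_f] trilin_scale3[OF trilin_f]
  trilin_zero1[OF trilin_f]
lemmas A_simps = assoc_algebraD(2,3)[OF algA]
lemmas act_simps = bimoduleD(4-6)[OF bimod]

definition hom :: "('a \<Rightarrow> 'm) \<Rightarrow> bool" where
  "hom p \<longleftrightarrow> (\<forall>x y. p (x + y) = p x + p y) \<and> (\<forall>r x. p (sA r x) = sM r (p x))"

definition K :: "('f, 'a, 'm) extension set" where
  "K = {(e, \<beta>, x, n, m, p). hom n \<and> hom p}"

lemma mem_K: "(e, \<beta>, x, n, m, p) \<in> K \<longleftrightarrow> hom n \<and> hom p"
  by (simp add: K_def)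

fun sK :: "'f \<Rightarrow> ('f, 'a, 'm) extension \<Rightarrow> ('f, 'a, 'm) extension" where
  "sK r (e, \<beta>, x, n, m, p) =
    (r * e, r * \<beta>, sA r x, (\<lambda>y. sM r (n y)), sM r m, (\<lambda>y. sM r (p y)))"

text \<open>The terms in \<open>p'\<close> are the action of the element (\<beta>, x) of A^+ on the
  class of (m', p') in N = W / M, to which \<open>m'\<close> does not contribute.\<close>

fun mK :: "('f, 'a, 'm) extension \<Rightarrow> ('f, 'a, 'm) extension \<Rightarrow> ('f, 'a, 'm) extension" where
  "mK (e, \<beta>, x, n, m, p) (e', \<beta>', x', n', m', p') =
    (e * e', e * \<beta>', sA e x', (\<lambda>y. sM e (n' y) + sM \<beta> (p' y) + la x (p' y)), 0, 0)"

text \<open>A left action on W alone: products have no part in W, and W annihilates everything to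
  its right, so both sides of \<open>u_mult\<close> vanish.\<close>

fun u :: "'a \<Rightarrow> ('f, 'a, 'm) extension \<Rightarrow> ('f, 'a, 'm) extension" where
  "u a (e, \<beta>, x, n, m, p) = (0, 0, 0, 0, la a m, (\<lambda>y. la a (p y)))"

text \<open>The term \<open>f x a y\<close> is the twist by h(x, a); \<beta> does not occur in it
  because h(1, a) is taken to be 0.\<close>

fun v :: "'a \<Rightarrow> ('f, 'a, 'm) extension \<Rightarrow> ('f, 'a, 'm) extension" where
  "v a (e, \<beta>, x, n, m, p) =
    (0, 0, sA \<beta> a + x * a, (\<lambda>y. n (a * y) - ra (n a) y - f x a y),
     ra m a + p a, (\<lambda>y. p (a * y) - ra (p a) y))"

definition h :: "'a \<Rightarrow> 'a \<Rightarrow> ('f, 'a, 'm) extension" where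
  "h a b = (0, 0, 0, 0, 0, (\<lambda>y. - f a b y))"

definition \<iota> :: "'m \<Rightarrow> ('f, 'a, 'm) extension" where
  "\<iota> m = (0, 0, 0, 0, m, 0)"

lemmas M_simps = M.scale_right_distrib M.scale_left_distrib M.scale_right_diff_distrib
lemmas all_simps = mem_K hom_def h_def \<iota>_def zero_prod_def fun_eq_iff M_simps A.scale_right_distrib
  A.scale_left_distrib la_simps ra_simps f_simps A_simps act_simps

lemma vector_space_sK: "vector_space sK"
  by unfold_locales (auto simp: all_simps algebra_simps)

lemma algebra_on_K: "algebra_on sK K mK"
  unfolding algebra_on_def
proof (intro conjI ballI allI)
  fix k l j r assume "k \<in> K" "l \<in> K" "j \<in> K"
  then show "k + l \<in> K" "mK k l \<in> K" "sK r k \<in> K"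
    "mK (k + l) j = mK k j + mK l j" "mK j (k + l) = mK j k + mK j l"
    "mK (sK r k) l = sK r (mK k l)" "mK k (sK r l) = sK r (mK k l)"
    "mK (mK k l) j = mK k (mK l j)"
    by (cases k; cases l; cases j; simp add: all_simps algebra_simps)+
qed (auto simp: vector_space_sK all_simps)

lemma anni_K: "Anni K mK = range \<iota>"
proof (intro equalityI subsetI)
  fix k assume k: "k \<in> Anni K mK"
  obtain e \<beta> x n m p where [simp]: "k = (e, \<beta>, x, n, m, p)" by (cases k)
  have "mK y k = 0" if "y \<in> K" for y using k that unfolding Anni_def by blast
  \<comment> \<open>These are the left unit and the unit of A^+. The first product forces
    \<open>e\<close>, \<beta>, \<open>x\<close> and \<open>n\<close> to vanish, the second
    \<open>p\<close>.\<close>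
  from this[of "(1, 0, 0, 0, 0, 0)"] this[of "(0, 1, 0, 0, 0, 0)"]
  have "mK (1, 0, 0, 0, 0, 0) k = 0" "mK (0, 1, 0, 0, 0, 0) k = 0"
    by (simp_all add: mem_K hom_def)
  then show "k \<in> range \<iota>" by (auto simp: all_simps)
qed (auto simp: Anni_def all_simps)

text \<open>The cocycle identity enters twice: on Q it is \<open>v_v\<close>, and in
  \<open>obs\<close> it clears the last entry. The entry in M of \<open>obs\<close> comes from
  \<open>v a3\<close>, which evaluates \<open>f a1 a2\<close> at \<open>a3\<close>.\<close>

sublocale obstruction_datum sA sM la ra f sK K mK \<iota> u v h
proof (rule obstruction_datum.intro)
  show "bilin sA sA sK h"
    by (rule bilinI) (auto simp: A.vector_space_axioms vector_space_sK all_simps)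
  show "Vector_Spaces.linear sM sK \<iota>"
    by (rule linearI) (auto simp: M.vector_space_axioms vector_space_sK all_simps)
  show "inj \<iota>" by (auto simp: inj_def \<iota>_def)
  show "algebra_on sK K mK" "Anni K mK = range \<iota>" by (fact algebra_on_K anni_K)+
qed (auto simp: algA bimod cocycle all_simps la_f algebra_simps)

section \<open>Embedding the extension into the function space\<close>

text \<open>A pair in the index supplies both the argument of \<open>n\<close> or \<open>p\<close>
  and the coordinate of its value. Linearity holds at every index, since an index only selects what
  is read.\<close>

lemma ex_linear_inj_into_index_functions:
  obtains \<Phi> :: "('f, 'a, 'm) extension \<Rightarrow> ('a \<times> 'm) list set \<Rightarrow> 'f"
  where "Vector_Spaces.linear sK (\<lambda>r x i. r * x i) \<Phi>" "inj \<Phi>"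
proof -
  obtain gA :: "'a \<Rightarrow> 'a \<Rightarrow> 'f" where gA:
    "\<And>x y i. gA (x + y) i = gA x i + gA y i" "\<And>r x i. gA (sA r x) i = r * gA x i" "inj gA"
    using ex_linear_inj_into_functions[OF A.vector_space_axioms] by blast
  obtain gM :: "'m \<Rightarrow> 'm \<Rightarrow> 'f" where gM:
    "\<And>x y i. gM (x + y) i = gM x i + gM y i" "\<And>r x i. gM (sM r x) i = r * gM x i" "inj gM"
    using ex_linear_inj_into_functions[OF M.vector_space_axioms] by blast
  \<comment> \<open>The length of the list in a singleton index selects the component of the tuple.\<close>
  define \<Phi> :: "('f, 'a, 'm) extension \<Rightarrow> ('a \<times> 'm) list set \<Rightarrow> 'f"
    where "\<Phi> = (\<lambda>(e, \<beta>, x, n, m, p) S. let l = the_elem S; j = length l; i = hd l in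
      if j = 0 then e else if j = 1 then \<beta> else if j = 2 then gA x (fst i)
      else if j = 3 then gM (n (fst i)) (snd i) else if j = 4 then gM m (snd i)
      else gM (p (fst i)) (snd i))"
  have "vector_space (\<lambda>(r::'f) (x::('a \<times> 'm) list set \<Rightarrow> 'f) i. r * x i)"
    by unfold_locales (auto simp: fun_eq_iff algebra_simps)
  then have "Vector_Spaces.linear sK (\<lambda>r x i. r * x i) \<Phi>"
    by (intro linearI vector_space_sK) (auto simp: \<Phi>_def Let_def fun_eq_iff gA gM)
  moreover have "inj \<Phi>"
  proof (rule injI)
    fix k k' assume eq: "\<Phi> k = \<Phi> k'"
    obtain e \<beta> x n m p where k: "k = (e, \<beta>, x, n, m, p)" by (cases k)
    obtain e' \<beta>' x' n' m' p' where k': "k' = (e', \<beta>', x', n', m', p')" by (cases k')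
    \<comment> \<open>A list of each length \<open>j\<close> reaches every component; for length 0
      the head is not consulted.\<close>
    have at: "\<Phi> k {replicate j (a, b)} = \<Phi> k' {replicate j (a, b)}" for j a b by (simp add: eq)
    have "e = e'" "\<beta> = \<beta>'" using at[of 0] at[of 1] by (simp_all add: \<Phi>_def k k')
    moreover have "gA x = gA x'" "gM m = gM m'"
      using at[of 2] at[of 4] by (simp_all add: \<Phi>_def k k' fun_eq_iff)
    then have "x = x'" "m = m'" using gA(3) gM(3) by (auto dest: injD)
    moreover have "gM (n a) = gM (n' a)" "gM (p a) = gM (p' a)" for a
      using at[of 3 a] at[of 5 a] by (simp_all add: \<Phi>_def k k' fun_eq_iff)
    then have "n = n'" "p = p'" using gM(3) by (auto dest: injD)
    ultimately show "k = k'" by (simp add: k k')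
  qed
  ultimately show ?thesis using that by blast
qed

end

theorem theorem1:
  fixes sA :: "'f::field \<Rightarrow> 'a::ring \<Rightarrow> 'a"
    and sM :: "'f \<Rightarrow> 'm::ab_group_add \<Rightarrow> 'm"
    and la :: "'a \<Rightarrow> 'm \<Rightarrow> 'm" and ra :: "'m \<Rightarrow> 'a \<Rightarrow> 'm"
    and c :: "('a \<Rightarrow> 'a \<Rightarrow> 'a \<Rightarrow> 'm) set"
  assumes "assoc_algebra sA"
    and "bimodule sA sM la ra"
    and "c \<in> HH3 sA sM la ra"
  shows "\<exists>(Kc :: (('a \<times> 'm) list set \<Rightarrow> 'f) set) mK (\<iota> :: 'm \<Rightarrow> (('a \<times> 'm) list set \<Rightarrow> 'f))
            \<xi> \<mu>.
     let sK = (\<lambda>(r::'f) (x::('a \<times> 'm) list set \<Rightarrow> 'f) i. r * x i) in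
       algebra_on sK Kc mK \<and>
       Vector_Spaces.linear sM sK \<iota> \<and> inj \<iota> \<and> range \<iota> \<subseteq> Kc \<and>
       Anni Kc mK = range \<iota> \<and>
       coupling sA sK Kc mK \<xi> \<and>
       bimult_law sA sK Kc mK \<xi> \<mu> \<and>
       (\<forall>a b. fst (\<mu> (a * b)) = fst (\<mu> a) \<circ> fst (\<mu> b)) \<and>
       (\<forall>a m. fst (\<mu> a) (\<iota> m) = \<iota> (la a m) \<and> snd (\<mu> a) (\<iota> m) = \<iota> (ra m a)) \<and>
       (\<exists>z\<in>c. \<forall>a1 a2 a3. Obs_rep sA sK Kc mK \<xi> a1 a2 a3 = \<iota> (z a1 a2 a3))"
proof -
  obtain f where f: "hoch_3cocycle sA sM la ra f" and c: "c = hh3_class sA sM la ra f"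
    using assms(3) by (auto simp: HH3_def)
  interpret C: cocycle_datum sA sM la ra f using assms(1,2) f by unfold_locales
  obtain \<Phi> :: "('f, 'a, 'm) extension \<Rightarrow> ('a \<times> 'm) list set \<Rightarrow> 'f"
    where \<Phi>: "Vector_Spaces.linear C.sK (\<lambda>r x i. r * x i) \<Phi>" "inj \<Phi>"
    by (rule C.ex_linear_inj_into_index_functions)
  \<comment> \<open>Moving the datum and not the conclusions spares a comparison of the
    \<open>SOME\<close> choices in \<open>Obs_rep\<close> before and after \<Phi>.\<close>
  interpret D: obstruction_datum sA sM la ra f "\<lambda>r x i. r * x i" "\<Phi> ` C.K"
    "\<lambda>x y. \<Phi> (C.mK (inv \<Phi> x) (inv \<Phi> y))" "\<lambda>m. \<Phi> (C.\<iota> m)" "\<lambda>a x. \<Phi> (C.u a (inv \<Phi> x))"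
    "\<lambda>a x. \<Phi> (C.v a (inv \<Phi> x))" "\<lambda>a b. \<Phi> (C.h a b)"
    by (rule C.transport[OF \<Phi>])
  have "range (\<lambda>m. \<Phi> (C.\<iota> m)) \<subseteq> \<Phi> ` C.K" using D.\<iota>_closed by blast
  then show ?thesis
    unfolding Let_def c
    using D.algK D.\<iota>_linear D.\<iota>_inj D.anni D.coupling_\<xi> D.bimult_law_\<mu> D.fst_\<mu>_times D.\<mu>_\<iota> D.Obs_rep_\<xi>
    by (intro exI[of _ "\<Phi> ` C.K"] exI[of _ "\<lambda>x y. \<Phi> (C.mK (inv \<Phi> x) (inv \<Phi> y))"]
        exI[of _ "\<lambda>m. \<Phi> (C.\<iota> m)"] exI[of _ D.\<xi>] exI[of _ D.\<mu>] conjI allI)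
qed

end
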